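(* Let $A$ and $B$ be closed subsets of a Euclidean space $X$ such that $A\cap B\ne\varnothing$, let $w\in A\cap B$, and let $L:=\mathrm{aff}(A\cup B)$. Suppose that $\{A,B\}$ is superregular at $w$ and affine-hull regular at $w$. Let $(x_n)_{n\in\mathbb{N}}$ be a generalized Douglas--Rachford sequence generated by $T:=(1-\alpha)\mathrm{Id}+\alpha P_B^\mu P_A^\lambda$ with $\lambda,\mu\in(0,2]$ and $\alpha\in(0,1)$, i.e., $x_{n+1}\in Tx_n$ for all $n\in\mathbb{N}$. Then the following hold: (i) If $\lambda=\mu=2$, then, whenever $P_Lx_0$ is sufficiently close to $w$, the sequence $(x_n)_{n\in\mathbb{N}}$ converges $R$-linearly to a point $\bar x\in\mathrm{Fix}\,T$ with $P_A\bar x=P_B\bar x\in A\cap B$. (ii) If either $\lambda<2$ or $\mu<2$, then, whenever $P_Lx_0$ is sufficiently close to $w$, the sequence $(x_n)_{n\in\mathbb{N}}$ converges $R$-linearly to a point $\bar x\in A\cap B$. Here "whenever $P_Lx_0$ is sufficiently close to $w$" means: there is $r>0$, not depending on the sequence, such that the conclusion holds whenever $\|P_Lx_0-w\|\le r$.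
   Context: $X$ is a Euclidean space with inner product $\langle\cdot,\cdot\rangle$ and norm $\|\cdot\|$. $\mathbb{B}(w;\rho)$ is the closed ball with center $w$ and radius $\rho$. $\mathrm{aff}$ denotes affine hull. For a nonempty closed set $C$: $d_C(x)=\inf_{c\in C}\|x-c\|$, $P_Cx=\{c\in C:\|x-c\|=d_C(x)\}$ (set-valued projector), and $P_C^\lambda:=(1-\lambda)\mathrm{Id}+\lambda P_C$ is the (set-valued) relaxed projector. Compositions of set-valued operators are $(ST)x=\bigcup_{y\in Tx}Sy$. $\mathrm{Fix}\,T=\{x\in X: x\in Tx\}$. "$P_A\bar x=P_B\bar x\in A\cap B$" means that $P_A\bar x$ and $P_B\bar x$ are singletons consisting of the same point, which lies in $A\cap B$. $(x_n)$ converges $R$-linearly to $\bar x$ if there are $\rho\in[0,1)$ and $\sigma\ge0$ with $\|x_n-\bar x\|\le\sigma\rho^n$ for all $n\in\mathbb{N}$. Normal cones: the proximal normal cone to $C$ at $x\in C$ is $N^{\rm prox}_C(x)=\{\lambda(z-x): x\in P_Cz,\ \lambda\ge0\}$. The limiting normal cone $N_C(x)$ is the set of $u\in X$ for which there exist $x_n\to x$ and $u_n\to u$ with $x_n\in C$ and $u_n\in N^{\rm prox}_C(x_n)$. Superregularity: $C$ is $(\varepsilon,\delta)$-regular at $w$ if for all $x,y\in C\cap\mathbb{B}(w;\delta)$ and $u\in N^{\rm prox}_C(x)$ one has $\langle u,x-y\rangle\ge-\varepsilon\|u\|\,\|x-y\|$; $C$ is superregular at $w$ if for every $\varepsilon>0$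 there is $\delta>0$ such that $C$ is $(\varepsilon,\delta)$-regular at $w$; $\{A,B\}$ is superregular at $w$ if both $A$ and $B$ are. Affine-hull regularity: $\{A,B\}$ is affine-hull regular at $w\in A\cap B$ if $N_A(w)\cap(-N_B(w))\cap(L-w)=\{0\}$, where $L=\mathrm{aff}(A\cup B)$. *)

theory Defs
  imports "HOL-Analysis.Analysis"
begin

text \<open>Set-valued operators on \<open>X\<close> are functions of type \<open>'a \<Rightarrow> 'a set\<close>.\<close>

definition projector :: "'a::euclidean_space set \<Rightarrow> 'a \<Rightarrow> 'a set" where
  "projector C x = {c \<in> C. norm (x - c) = infdist x C}"

text \<open>For set-valued \<open>T\<close>, \<open>relax \<gamma> T\<close> is \<open>(1 - \<gamma>) Id + \<gamma> T\<close>.\<close>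

definition relax :: "real \<Rightarrow> ('a::euclidean_space \<Rightarrow> 'a set) \<Rightarrow> 'a \<Rightarrow> 'a set" where
  "relax \<gamma> T x = {(1 - \<gamma>) *\<^sub>R x + \<gamma> *\<^sub>R y | y. y \<in> T x}"

definition relaxed_projector :: "'a::euclidean_space set \<Rightarrow> real \<Rightarrow> 'a \<Rightarrow> 'a set" where
  "relaxed_projector C \<gamma> = relax \<gamma> (projector C)"

definition op_comp :: "('a \<Rightarrow> 'a set) \<Rightarrow> ('a \<Rightarrow> 'a set) \<Rightarrow> 'a \<Rightarrow> 'a set" where
  "op_comp S T x = (\<Union>y\<in>T x. S y)"

definition Fix :: "('a \<Rightarrow> 'a set) \<Rightarrow> 'a set" where
  "Fix T = {x. x \<in> T x}"

definition gDR_operator ::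
    "'a::euclidean_space set \<Rightarrow> 'a set \<Rightarrow> real \<Rightarrow> real \<Rightarrow> real \<Rightarrow> 'a \<Rightarrow> 'a set" where
  "gDR_operator A B lam \<mu> \<alpha> =
     relax \<alpha> (op_comp (relaxed_projector B \<mu>) (relaxed_projector A lam))"

definition generated_by :: "('a \<Rightarrow> 'a set) \<Rightarrow> (nat \<Rightarrow> 'a) \<Rightarrow> bool" where
  "generated_by T x \<longleftrightarrow> (\<forall>n. x (Suc n) \<in> T (x n))"

definition R_linearly_converges :: "(nat \<Rightarrow> 'a::euclidean_space) \<Rightarrow> 'a \<Rightarrow> bool" where
  "R_linearly_converges x xbar \<longleftrightarrow>
     (\<exists>\<rho> \<sigma>. 0 \<le> \<rho> \<and> \<rho> < 1 \<and> 0 \<le> \<sigma> \<and> (\<forall>n. norm (x n - xbar) \<le> \<sigma> * \<rho> ^ n))"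

definition prox_normal_cone :: "'a::euclidean_space set \<Rightarrow> 'a \<Rightarrow> 'a set" where
  "prox_normal_cone C x = {t *\<^sub>R (z - x) | t z. x \<in> projector C z \<and> 0 \<le> t}"

definition limiting_normal_cone :: "'a::euclidean_space set \<Rightarrow> 'a \<Rightarrow> 'a set" where
  "limiting_normal_cone C x =
     {u. \<exists>y v. y \<longlonglongrightarrow> x \<and> v \<longlonglongrightarrow> u \<and>
         (\<forall>n::nat. y n \<in> C \<and> v n \<in> prox_normal_cone C (y n))}"

definition eps_delta_regular_at :: "real \<Rightarrow> real \<Rightarrow> 'a::euclidean_space set \<Rightarrow> 'a \<Rightarrow> bool" where
  "eps_delta_regular_at \<epsilon> \<delta> C w \<longleftrightarrow>
     (\<forall>x \<in> C \<inter> cball w \<delta>. \<forall>y \<in> C \<inter> cball w \<delta>. \<forall>u \<in> prox_normal_cone C x.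
        u \<bullet> (x - y) \<ge> - \<epsilon> * norm u * norm (x - y))"

definition superregular_at :: "'a::euclidean_space set \<Rightarrow> 'a \<Rightarrow> bool" where
  "superregular_at C w \<longleftrightarrow> (\<forall>\<epsilon>>0. \<exists>\<delta>>0. eps_delta_regular_at \<epsilon> \<delta> C w)"

definition affine_hull_regular_at ::
    "'a::euclidean_space set \<Rightarrow> 'a set \<Rightarrow> 'a \<Rightarrow> bool" where
  "affine_hull_regular_at A B w \<longleftrightarrow>
     limiting_normal_cone A w \<inter> uminus ` limiting_normal_cone B w
       \<inter> (\<lambda>z. z - w) ` (affine hull (A \<union> B)) = {0}"

end

theory Submission
  imports Defs
begin

text \<open>
  Split \<open>x\<^sub>n\<close> into its component in \<open>L = aff (A \<union> B)\<close> and the one orthogonal to \<open>L\<close>. Projections onto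
  \<open>A\<close> and \<open>B\<close> ignore the orthogonal component, so \<open>T\<close> multiplies it by
  \<open>\<tau> = 1 - \<alpha> + \<alpha> (1 - \<lambda>) (1 - \<mu>)\<close>, where \<open>\<tau> = 1\<close> if \<open>\<lambda> = \<mu> = 2\<close> and \<open>\<bar>\<tau>\<bar> < 1\<close> otherwise.

  In \<open>L\<close>, superregularity makes both relaxed projections almost nonexpansive towards the nearest
  point of \<open>A \<inter> B\<close>. Affine-hull regularity bounds the angle between proximal normals of \<open>A\<close> and \<open>B\<close>
  away from \<open>\<pi>\<close>, so the displacement of a step controls the distances to \<open>A\<close> and \<open>B\<close>, and these in turn
  control the distance to \<open>A \<inter> B\<close>. The term \<open>- \<alpha> (1 - \<alpha>) \<parallel>x - z\<parallel>\<^sup>2\<close> gained by averaging then makes the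
  distance to \<open>A \<inter> B\<close> decrease geometrically, and so do the steps.
\<close>

section \<open>Projectors and proximal normals\<close>

lemma mem_projector_iff:
  assumes "C \<noteq> {}"
  shows "c \<in> projector C x \<longleftrightarrow> c \<in> C \<and> (\<forall>y\<in>C. norm (x - c) \<le> norm (x - y))"
proof
  assume "c \<in> projector C x"
  then show "c \<in> C \<and> (\<forall>y\<in>C. norm (x - c) \<le> norm (x - y))"
    using infdist_le[of _ C x] by (auto simp: projector_def dist_norm)
next
  assume c: "c \<in> C \<and> (\<forall>y\<in>C. norm (x - c) \<le> norm (x - y))"
  then have "infdist x C \<ge> norm (x - c)"
    using assms by (auto simp: infdist_def dist_norm intro!: cINF_greatest)
  with c infdist_le[of c C x] show "c \<in> projector C x"
    by (auto simp: projector_def dist_norm)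
qed

lemma projector_nonempty:
  assumes "closed C" "C \<noteq> {}"
  shows "\<exists>c. c \<in> projector C x"
proof -
  obtain c where "c \<in> C" "infdist x C = dist x c"
    using infdist_attains_inf[OF assms] by blast
  then show ?thesis by (auto simp: projector_def dist_norm)
qed

lemma projector_le:
  assumes "c \<in> projector C x" "y \<in> C"
  shows "norm (x - c) \<le> norm (x - y)"
  using assms mem_projector_iff by blast

lemma projector_mem: "c \<in> projector C x \<Longrightarrow> c \<in> C"
  by (simp add: projector_def)

lemma projector_dist:
  assumes "c \<in> projector C x" "w \<in> C"
  shows "norm (c - w) \<le> 2 * norm (x - w)"
proof -
  have "norm (c - w) \<le> norm (x - c) + norm (x - w)"
    using norm_triangle_ineq[of "c - x" "x - w"] by (simp add: norm_minus_commute)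
  with projector_le[OF assms] show ?thesis by linarith
qed

lemma prox_normal_coneI: "c \<in> projector C x \<Longrightarrow> x - c \<in> prox_normal_cone C c"
  unfolding prox_normal_cone_def by (force intro: exI[of _ "1::real"])

lemma prox_normal_cone_scale:
  assumes "u \<in> prox_normal_cone C c" "0 \<le> s"
  shows "s *\<^sub>R u \<in> prox_normal_cone C c"
proof -
  obtain t z where "u = t *\<^sub>R (z - c)" "c \<in> projector C z" "0 \<le> t"
    using assms(1) by (auto simp: prox_normal_cone_def)
  then show ?thesis
    using assms(2) unfolding prox_normal_cone_def
    by (intro CollectI exI[of _ "s * t"] exI[of _ z]) auto
qed

lemma eps_delta_regularD:
  assumes "eps_delta_regular_at \<epsilon> \<delta> C w" and a: "a \<in> projector C x" "norm (a - w) \<le> \<delta>"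
    and "c \<in> C" "norm (c - w) \<le> \<delta>"
  shows "- \<epsilon> * norm (x - a) * norm (a - c) \<le> (x - a) \<bullet> (a - c)"
proof -
  have "a \<in> C \<inter> cball w \<delta>" "c \<in> C \<inter> cball w \<delta>"
    using assms projector_mem[OF a(1)] by (auto simp: dist_norm norm_minus_commute)
  with assms(1) prox_normal_coneI[OF a(1)] show ?thesis unfolding eps_delta_regular_at_def by blast
qed

section \<open>Convergence from geometrically decaying steps\<close>

text \<open>The step estimate is available only within distance \<open>R\<close> of
  \<open>w\<close>. The steps sum to at most \<open>K * e 0 / (1 - \<rho>)\<close>, so
  \<open>start\<close> keeps all iterates in that ball, and the same sum makes the sequence Cauchy.
  This serves both for alternating projections and for the sequence generated by the
  operator.\<close>

lemma geometric_steps_converge: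
  fixes x :: "nat \<Rightarrow> 'a::banach" and e :: "nat \<Rightarrow> real"
  assumes \<rho>: "0 \<le> \<rho>" "\<rho> < 1" and K: "0 \<le> K" and e: "\<And>n. 0 \<le> e n"
    and step: "\<And>n. norm (x n - w) \<le> R \<Longrightarrow> e (Suc n) \<le> \<rho> * e n \<and> norm (x (Suc n) - x n) \<le> K * e n"
    and start: "norm (x 0 - w) + K * e 0 / (1 - \<rho>) \<le> R"
  obtains l where "\<And>n. norm (x n - l) \<le> K * e 0 / (1 - \<rho>) * \<rho> ^ n" "\<And>n. e n \<le> e 0 * \<rho> ^ n"
proof -
  define M where "M = K * e 0 / (1 - \<rho>)"
  have M: "0 \<le> M" "M * (1 - \<rho>) = K * e 0" using \<rho> K e[of 0] by (auto simp: M_def)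
  \<comment> \<open>The partial geometric sum is part of the induction claim: a bare bound by
    \<open>R\<close> would not survive the next step.\<close>
  have main: "norm (x n - w) \<le> norm (x 0 - w) + M * (1 - \<rho> ^ n) \<and> e n \<le> e 0 * \<rho> ^ n" for n
  proof (induction n)
    case (Suc n)
    have "M * (1 - \<rho> ^ n) \<le> M" using M \<rho> by (simp add: mult_left_le)
    then have "norm (x n - w) \<le> R" using Suc start by (simp add: M_def)
    note s = step[OF this]
    have "K * e n \<le> K * (e 0 * \<rho> ^ n)" using Suc K by (intro mult_left_mono) auto
    also have "\<dots> = M * (1 - \<rho>) * \<rho> ^ n" using M by simp
    finally have 1: "norm (x (Suc n) - x n) \<le> M * (1 - \<rho>) * \<rho> ^ n" using s by linarith
    have "norm (x (Suc n) - w) \<le> norm (x (Suc n) - x n) + norm (x n - w)"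
      using norm_triangle_ineq[of "x (Suc n) - x n" "x n - w"] by simp
    with 1 Suc have 2: "norm (x (Suc n) - w) \<le> norm (x 0 - w) + M * (1 - \<rho> ^ Suc n)"
      by (simp add: algebra_simps)
    have "\<rho> * e n \<le> \<rho> * (e 0 * \<rho> ^ n)" using Suc \<rho> by (intro mult_left_mono) auto
    with s 2 show ?case by (simp add: mult_ac)
  qed simp
  \<comment> \<open>With \<open>K * e 0 = M * (1 - \<rho>)\<close>, each step is bounded by a
    difference of consecutive terms, so the sums telescope.\<close>
  have stepn: "norm (x (Suc n) - x n) \<le> M * \<rho> ^ n - M * \<rho> ^ Suc n" for n
  proof -
    have "M * (1 - \<rho> ^ n) \<le> M" using M \<rho> by (simp add: mult_left_le)
    then have "norm (x n - w) \<le> R" using main[of n] start by (simp add: M_def)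
    from step[OF this] have "norm (x (Suc n) - x n) \<le> K * e n" by simp
    also have "\<dots> \<le> K * (e 0 * \<rho> ^ n)" using main K by (intro mult_left_mono) auto
    also have "\<dots> = M * (1 - \<rho>) * \<rho> ^ n" using M by simp
    finally show ?thesis by (simp add: algebra_simps)
  qed
  have tele: "norm (x (n + k) - x n) \<le> M * \<rho> ^ n - M * \<rho> ^ (n + k)" for n k
  proof (induction k)
    case (Suc k)
    have "norm (x (n + Suc k) - x n) \<le> norm (x (Suc (n + k)) - x (n + k)) + norm (x (n + k) - x n)"
      using norm_triangle_ineq[of "x (Suc (n + k)) - x (n + k)" "x (n + k) - x n"] by simp
    with Suc stepn[of "n + k"] show ?case by simp
  qed simp
  have bound: "norm (x m - x n) \<le> M * \<rho> ^ n" if "n \<le> m" for m n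
  proof -
    have "norm (x m - x n) \<le> M * \<rho> ^ n - M * \<rho> ^ m" using tele[of n "m - n"] that by simp
    moreover have "0 \<le> M * \<rho> ^ m" using M \<rho> by simp
    ultimately show ?thesis by linarith
  qed
  have "(\<lambda>n. M * \<rho> ^ n) \<longlonglongrightarrow> M * 0" using \<rho> by (intro tendsto_intros LIMSEQ_realpow_zero) auto
  then have lim0: "(\<lambda>n. M * \<rho> ^ n) \<longlonglongrightarrow> 0" by simp
  have "Cauchy x"
  proof (rule CauchyI')
    fix d :: real assume "0 < d"
    then obtain N where N: "\<And>n. n \<ge> N \<Longrightarrow> M * \<rho> ^ n < d"
      using order_tendstoD(2)[OF lim0, of d] by (auto simp: eventually_sequentially)
    show "\<exists>N. \<forall>m\<ge>N. \<forall>n>m. dist (x m) (x n) < d"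
      unfolding dist_norm by (intro exI[of _ N] allI impI) (metis N bound less_imp_le norm_minus_commute order.strict_trans1)
  qed
  then obtain l where l: "x \<longlonglongrightarrow> l" using Cauchy_convergent_iff convergent_def by blast
  have "norm (x n - l) \<le> M * \<rho> ^ n" for n
  proof -
    have "(\<lambda>m. norm (x n - x m)) \<longlonglongrightarrow> norm (x n - l)" by (intro tendsto_intros l)
    then show ?thesis
      using bound[of n] by (intro LIMSEQ_le_const2) (auto simp: norm_minus_commute)
  qed
  with main show thesis by (intro that) (auto simp: M_def)
qed

section \<open>Uniform angle between normals of the two sets\<close>

text \<open>Compactness turns the condition on limiting cones at \<open>w\<close> into a uniform one
  nearby. If it failed, there would be unit proximal normals in \<open>S\<close> at points tending
  to \<open>w\<close> with inner products tending to -1; their limits would be opposite and nonzero,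
  against regularity.\<close>

lemma affine_hull_regular_angle:
  fixes A B :: "'a::euclidean_space set"
  assumes reg: "affine_hull_regular_at A B w" and w: "w \<in> A \<inter> B"
  defines "S \<equiv> (\<lambda>z. z - w) ` (affine hull (A \<union> B))"
  obtains \<theta> \<delta> where "0 \<le> \<theta>" "\<theta> < 1" "0 < \<delta>"
    "\<And>a b u v. \<lbrakk>a \<in> A; norm (a - w) \<le> \<delta>; b \<in> B; norm (b - w) \<le> \<delta>; u \<in> prox_normal_cone A a;
       v \<in> prox_normal_cone B b; u \<in> S; v \<in> S\<rbrakk> \<Longrightarrow> - \<theta> * norm u * norm v \<le> u \<bullet> v"
proof (rule ccontr)
  assume neg: "\<not> thesis"
  have wL: "w \<in> affine hull (A \<union> B)" using w by (simp add: hull_inc)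
  have S: "subspace S" "closed S"
    unfolding S_def using affine_diffs_subspace_subtract[OF affine_affine_hull wL] closed_subspace by auto
  \<comment> \<open>\<open>q n\<close> is used twice: as the radius around \<open>w\<close>, and as
    the gap in the candidate \<open>\<theta> = 1 - q n\<close>.\<close>
  define q where "q n = inverse (real (Suc n))" for n
  have q: "0 < q n" "q n \<le> 1" for n by (auto simp: q_def field_simps)
  have "q \<longlonglongrightarrow> 0" unfolding q_def by (rule LIMSEQ_inverse_real_of_nat)
  have "\<exists>a b u v. a \<in> A \<and> norm (a - w) \<le> q n \<and> b \<in> B \<and> norm (b - w) \<le> q n \<and> u \<in> prox_normal_cone A a \<and>
       v \<in> prox_normal_cone B b \<and> u \<in> S \<and> v \<in> S \<and> norm u = 1 \<and> norm v = 1 \<and> u \<bullet> v \<le> - (1 - q n)" for n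
  proof -
    from neg that[of "1 - q n" "q n"] q[of n]
    obtain a b u v where ab: "a \<in> A" "norm (a - w) \<le> q n" "b \<in> B" "norm (b - w) \<le> q n"
      "u \<in> prox_normal_cone A a" "v \<in> prox_normal_cone B b" "u \<in> S" "v \<in> S"
      and lt: "u \<bullet> v < - (1 - q n) * norm u * norm v" by fastforce
    from lt have nz: "u \<noteq> 0" "v \<noteq> 0" by auto
    define u' v' where "u' = (1 / norm u) *\<^sub>R u" and "v' = (1 / norm v) *\<^sub>R v"
    have "u' \<bullet> v' = (u \<bullet> v) / (norm u * norm v)" by (simp add: u'_def v'_def)
    also have "\<dots> \<le> - (1 - q n)" using lt nz by (subst pos_divide_le_eq) (auto simp: mult_ac)
    finally have "u' \<bullet> v' \<le> - (1 - q n)" .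
    moreover have "norm u' = 1" "norm v' = 1" using nz by (auto simp: u'_def v'_def)
    moreover have "u' \<in> prox_normal_cone A a" "v' \<in> prox_normal_cone B b"
      unfolding u'_def v'_def using ab by (auto intro!: prox_normal_cone_scale)
    moreover have "u' \<in> S" "v' \<in> S" using S(1) ab by (simp_all add: u'_def v'_def subspace_scale)
    ultimately show ?thesis using ab by blast
  qed
  then obtain a b u v where ab: "\<And>n. a n \<in> A" "\<And>n. norm (a n - w) \<le> q n" "\<And>n. b n \<in> B" "\<And>n. norm (b n - w) \<le> q n"
      and uv: "\<And>n. u n \<in> prox_normal_cone A (a n)" "\<And>n. v n \<in> prox_normal_cone B (b n)"
      "\<And>n. u n \<in> S" "\<And>n. norm (u n) = 1" "\<And>n. norm (v n) = 1" "\<And>n. u n \<bullet> v n \<le> - (1 - q n)"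
    by metis
  have alim: "a \<longlonglongrightarrow> w" "b \<longlonglongrightarrow> w"
    using ab(2,4) \<open>q \<longlonglongrightarrow> 0\<close>
    by (auto intro!: LIM_zero_cancel[of a] LIM_zero_cancel[of b] intro: Lim_null_comparison[OF always_eventually])
  \<comment> \<open>Compactness is applied to the pairs, so that one subsequence serves both
    normals.\<close>
  have sph: "\<forall>n. (u n, v n) \<in> sphere 0 1 \<times> sphere 0 1" using uv by auto
  have "compact (sphere (0::'a) 1 \<times> sphere (0::'a) 1)" by (intro compact_Times compact_sphere)
  then obtain l r where lr: "l \<in> sphere 0 1 \<times> sphere (0::'a) 1" "strict_mono (r :: nat \<Rightarrow> nat)"
      "((\<lambda>n. (u n, v n)) \<circ> r) \<longlonglongrightarrow> l" by (rule seq_compactE[OF compact_imp_seq_compact sph])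
  obtain u0 v0 where l: "l = (u0, v0)" by (cases l)
  have ul: "(u \<circ> r) \<longlonglongrightarrow> u0" and vl: "(v \<circ> r) \<longlonglongrightarrow> v0"
    using tendsto_fst[OF lr(3)] tendsto_snd[OF lr(3)] by (auto simp: l o_def)
  have al: "(a \<circ> r) \<longlonglongrightarrow> w" "(b \<circ> r) \<longlonglongrightarrow> w" "(q \<circ> r) \<longlonglongrightarrow> 0"
    using alim \<open>q \<longlonglongrightarrow> 0\<close> lr(2) by (auto intro: LIMSEQ_subseq_LIMSEQ)
  have n1: "norm u0 = 1" "norm v0 = 1" using lr(1) by (auto simp: l)
  have "u0 \<bullet> v0 \<le> - (1 - 0)"
  proof (rule LIMSEQ_le)
    show "(\<lambda>n. (u \<circ> r) n \<bullet> (v \<circ> r) n) \<longlonglongrightarrow> u0 \<bullet> v0" by (intro tendsto_intros ul vl)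
    show "(\<lambda>n. - (1 - (q \<circ> r) n)) \<longlonglongrightarrow> - (1 - 0)" by (intro tendsto_intros al)
  qed (use uv in auto)
  \<comment> \<open>Two unit vectors with inner product at most -1 have a sum of norm 0.\<close>
  moreover have "(norm (u0 + v0))\<^sup>2 = (norm u0)\<^sup>2 + 2 * (u0 \<bullet> v0) + (norm v0)\<^sup>2"
    by (simp add: power2_norm_eq_inner inner_add inner_commute algebra_simps)
  ultimately have "(norm (u0 + v0))\<^sup>2 \<le> 0" using n1 by simp
  then have uv0: "u0 = - v0" by (simp add: eq_neg_iff_add_eq_0)
  have "u0 \<in> limiting_normal_cone A w" unfolding limiting_normal_cone_def
    using al ul ab uv by (intro CollectI exI[of _ "a \<circ> r"] exI[of _ "u \<circ> r"]) auto
  moreover have "v0 \<in> limiting_normal_cone B w" unfolding limiting_normal_cone_def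
    using al vl ab uv by (intro CollectI exI[of _ "b \<circ> r"] exI[of _ "v \<circ> r"]) auto
  moreover have "u0 \<in> S" using closed_sequentially[OF S(2) _ ul] uv by simp
  ultimately have "u0 \<in> {0}"
    using reg uv0 unfolding affine_hull_regular_at_def S_def by blast
  with n1 show False by simp
qed

section \<open>Alternating projections and linear regularity near \<open>w\<close>\<close>

lemma affine_diff_mem:
  assumes "affine L" "w \<in> L" "p \<in> L" "q \<in> L"
  shows "p - q \<in> (\<lambda>z. z - w) ` L"
  using subspace_diff[OF affine_diffs_subspace_subtract[OF assms(1,2)], of "p - w" "q - w"] assms(3,4) by auto

lemma le_geometric_imp_nonpos:
  fixes c :: real
  assumes "0 \<le> \<rho>" "\<rho> < 1" "\<And>n. c \<le> M * \<rho> ^ n"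
  shows "c \<le> 0"
proof -
  have "(\<lambda>n. M * \<rho> ^ n) \<longlonglongrightarrow> M * 0" using assms by (intro tendsto_intros LIMSEQ_realpow_zero) auto
  from LIMSEQ_le_const[OF this] assms(3) show ?thesis by auto
qed

lemma mem_closed_if_geometric:
  assumes "closed C" "C \<noteq> {}" "0 \<le> \<rho>" "\<rho> < 1"
    and "\<And>n. norm (x n - l) \<le> M * \<rho> ^ n" and "\<And>n. infdist (x n) C \<le> N * \<rho> ^ n"
  shows "l \<in> C"
proof -
  have "infdist l C \<le> (N + M) * \<rho> ^ n" for n
    using infdist_triangle[of l C "x n"] assms(5,6)[of n] by (simp add: dist_norm norm_minus_commute algebra_simps)
  then have "infdist l C \<le> 0" by (rule le_geometric_imp_nonpos[OF assms(3,4)])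
  then show ?thesis using in_closed_iff_infdist_zero[OF assms(1,2)] infdist_nonneg[of l C] by simp
qed

text \<open>Read \<open>u = b - a'\<close> and \<open>v = a' - b'\<close> for consecutive
  projections \<open>b\<close>, \<open>a'\<close>, \<open>b'\<close>, so that
  \<open>u + v = b - b'\<close>. Then
  \<open>v \<bullet> v = v \<bullet> (u + v) - u \<bullet> v\<close>: superregularity bounds the
  first term, the angle the second, and a factor \<open>norm v\<close> cancels.\<close>

lemma alternating_projection_estimate:
  fixes u v :: "'a::real_inner"
  assumes angle: "- \<theta> * norm u * norm v \<le> u \<bullet> v" and reg: "- \<epsilon> * norm v * norm (u + v) \<le> - (v \<bullet> (u + v))"
    and le: "norm v \<le> norm u" and nn: "0 \<le> \<theta>" "0 \<le> \<epsilon>"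
  shows "norm v \<le> (\<theta> + 2 * \<epsilon>) * norm u"
proof (cases "v = 0")
  case False
  have "norm v * norm v = v \<bullet> (u + v) - u \<bullet> v"
    by (simp add: inner_add_right inner_commute power2_norm_eq_inner flip: power2_eq_square)
  also have "\<dots> \<le> \<epsilon> * norm v * norm (u + v) + \<theta> * norm u * norm v" using angle reg by linarith
  also have "\<epsilon> * norm v * norm (u + v) \<le> \<epsilon> * norm v * (2 * norm u)"
    using norm_triangle_ineq[of u v] le nn by (intro mult_left_mono) auto
  finally have "norm v * norm v \<le> norm v * ((\<theta> + 2 * \<epsilon>) * norm u)" by (simp add: algebra_simps)
  then show ?thesis using False by simp
qed (use nn in simp)

text \<open>Near \<open>w\<close> the method of alternating projections contracts the gap, and its limit is a point
  of \<open>A \<inter> B\<close> whose distance from the start is of the order of the initial gap.\<close>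

lemma linear_regularity:
  fixes A B :: "'a::euclidean_space set"
  assumes "closed A" "closed B" and w: "w \<in> A \<inter> B"
    and "superregular_at B w" and "affine_hull_regular_at A B w"
  obtains \<kappa> \<delta> where "1 \<le> \<kappa>" "0 < \<delta>"
    "\<And>x. norm (x - w) \<le> \<delta> \<Longrightarrow> \<exists>c\<in>A \<inter> B. norm (x - c) \<le> \<kappa> * (infdist x A + infdist x B)"
proof -
  define S where "S = (\<lambda>z. z - w) ` (affine hull (A \<union> B))"
  have ne: "A \<noteq> {}" "B \<noteq> {}" using w by auto
  have inS: "p - q \<in> S" if "p \<in> A \<union> B" "q \<in> A \<union> B" for p q
    unfolding S_def using w that by (intro affine_diff_mem affine_affine_hull hull_inc) auto
  from affine_hull_regular_angle[OF assms(5) w, folded S_def]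
  obtain \<theta> \<delta>1 where \<theta>: "0 \<le> \<theta>" "\<theta> < 1" "0 < \<delta>1"
    and angle: "\<And>a b u v. \<lbrakk>a \<in> A; norm (a - w) \<le> \<delta>1; b \<in> B; norm (b - w) \<le> \<delta>1; u \<in> prox_normal_cone A a;
       v \<in> prox_normal_cone B b; u \<in> S; v \<in> S\<rbrakk> \<Longrightarrow> - \<theta> * norm u * norm v \<le> u \<bullet> v" by blast
  \<comment> \<open>This choice makes the contraction factor \<open>\<rho>\<close> equal to
    \<open>(1 + \<theta>) / 2\<close>.\<close>
  define \<epsilon> where "\<epsilon> = (1 - \<theta>) / 4"
  define \<rho> where "\<rho> = \<theta> + 2 * \<epsilon>"
  have \<epsilon>: "0 < \<epsilon>" and \<rho>: "0 \<le> \<rho>" "\<rho> < 1" using \<theta> by (auto simp: \<epsilon>_def \<rho>_def field_simps)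
  obtain \<delta>2 where \<delta>2: "0 < \<delta>2" "eps_delta_regular_at \<epsilon> \<delta>2 B w"
    using assms(4) \<epsilon> by (auto simp: superregular_at_def)
  \<comment> \<open>Each projection at most doubles the distance to \<open>w\<close>, and three are
    made in passing from \<open>a\<close> to \<open>b\<close>, \<open>a'\<close> and
    \<open>b'\<close>.\<close>
  define R where "R = min \<delta>1 \<delta>2 / 8"
  have R: "0 < R" "8 * R \<le> \<delta>1" "8 * R \<le> \<delta>2" using \<theta> \<delta>2 by (auto simp: R_def)
  obtain prA where prA: "\<And>x. prA x \<in> projector A x" using projector_nonempty[OF assms(1) ne(1)] by metis
  obtain prB where prB: "\<And>x. prB x \<in> projector B x" using projector_nonempty[OF assms(2) ne(2)] by metis
  have memA: "prA x \<in> A" and memB: "prB x \<in> B" for x using prA prB projector_mem by blast+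
  have dA: "norm (prA x - w) \<le> 2 * norm (x - w)" and dB: "norm (prB x - w) \<le> 2 * norm (x - w)" for x
    using projector_dist[OF prA] projector_dist[OF prB] w by auto
  have contr: "norm (a' - prB a') \<le> \<rho> * norm (a - prB a)" and move: "norm (a' - a) \<le> 2 * norm (a - prB a)"
    if a: "a \<in> A" "norm (a - w) \<le> R" and a': "a' = prA (prB a)" for a a'
  proof -
    define b where "b = prB a"
    define b' where "b' = prB a'"
    have near: "norm (b - w) \<le> 2 * R" "norm (a' - w) \<le> 4 * R" "norm (b' - w) \<le> 8 * R"
      using dB[of a] dA[of b] dB[of a'] a by (auto simp: b_def b'_def a')
    have le: "norm (b - a') \<le> norm (b - a)" "norm (a' - b') \<le> norm (a' - b)"
      using projector_le[OF prA a(1), of b] projector_le[OF prB memB, of a' a]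
      by (auto simp: b_def b'_def a')
    have "- \<theta> * norm (b - a') * norm (a' - b') \<le> (b - a') \<bullet> (a' - b')"
      using near R prA[of b] prB[of a'] memA memB
      by (intro angle[of a' b'] inS prox_normal_coneI) (auto simp: b_def b'_def a')
    \<comment> \<open>Superregularity of \<open>B\<close> is used at \<open>b'\<close>, with normal
      \<open>a' - b'\<close> and comparison point \<open>b\<close>.\<close>
    moreover have "- \<epsilon> * norm (a' - b') * norm ((b - a') + (a' - b')) \<le> - ((a' - b') \<bullet> ((b - a') + (a' - b')))"
    proof -
      have "(a' - b') \<bullet> (b' - b) \<ge> - \<epsilon> * norm (a' - b') * norm (b' - b)"
        unfolding b'_def using near R memB
        by (intro eps_delta_regularD[OF \<delta>2(2) prB]) (auto simp: b_def b'_def)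
      then show ?thesis by (simp add: norm_minus_commute inner_diff_right)
    qed
    ultimately have "norm (a' - b') \<le> \<rho> * norm (b - a')"
      unfolding \<rho>_def using le \<theta> \<epsilon> by (intro alternating_projection_estimate) (auto simp: norm_minus_commute)
    also have "\<dots> \<le> \<rho> * norm (a - b)" using le \<rho> by (intro mult_left_mono) (auto simp: norm_minus_commute)
    finally show "norm (a' - prB a') \<le> \<rho> * norm (a - prB a)" by (simp add: b_def b'_def)
    show "norm (a' - a) \<le> 2 * norm (a - prB a)"
      using norm_triangle_ineq[of "a' - b" "b - a"] le by (simp add: b_def norm_minus_commute)
  qed
  \<comment> \<open>Both \<open>norm (a 0 - w)\<close> and the initial gap \<open>e 0\<close> are at
    most \<open>2 * \<delta>\<close>. Hence the start contributes at most \<open>R / 3\<close> and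
    the total movement \<open>4 * \<delta> / (1 - \<rho>)\<close> at most
    \<open>2 * R / 3\<close>.\<close>
  define \<delta> where "\<delta> = R * (1 - \<rho>) / 6"
  \<comment> \<open>The 1 pays for the way from \<open>x\<close> to \<open>a 0\<close>, the fraction
    for the way from \<open>a 0\<close> to the limit, as \<open>e 0\<close> is at most the sum of
    the two distances.\<close>
  define \<kappa> where "\<kappa> = 1 + 2 / (1 - \<rho>)"
  have main: "\<exists>c\<in>A \<inter> B. norm (x - c) \<le> \<kappa> * (infdist x A + infdist x B)" if x: "norm (x - w) \<le> \<delta>" for x
  proof -
    define a where "a n = ((\<lambda>y. prA (prB y)) ^^ n) (prA x)" for n
    define e where "e n = norm (a n - prB (a n))" for n
    have aSuc: "a (Suc n) = prA (prB (a n))" for n by (simp add: a_def)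
    have aA: "a n \<in> A" for n by (cases n) (auto simp: aSuc memA a_def)
    have e_inf: "e n = infdist (a n) B" for n using prB[of "a n"] by (simp add: e_def projector_def)
    have x_inf: "norm (x - a 0) = infdist x A" using prA[of x] by (simp add: a_def projector_def)
    have "norm (a 0 - w) \<le> 2 * \<delta>" using dA[of x] x by (simp add: a_def)
    moreover have "e 0 \<le> 2 * \<delta>"
      using projector_le[OF prB, of w "a 0"] w calculation by (simp add: e_def)
    moreover have "2 * \<delta> + 2 * (2 * \<delta>) / (1 - \<rho>) \<le> R"
    proof -
      have "2 * (2 * \<delta>) / (1 - \<rho>) = 2 * R / 3" using \<rho> by (simp add: \<delta>_def divide_simps)
      moreover have "R * (1 - \<rho>) \<le> R" using \<rho> R(1) by (simp add: mult_left_le)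
      ultimately show ?thesis by (simp add: \<delta>_def)
    qed
    moreover have "2 * e 0 / (1 - \<rho>) \<le> 2 * (2 * \<delta>) / (1 - \<rho>)"
      using calculation \<rho> by (intro divide_right_mono) auto
    ultimately have start: "norm (a 0 - w) + 2 * e 0 / (1 - \<rho>) \<le> R" by linarith
    obtain c where c: "\<And>n. norm (a n - c) \<le> 2 * e 0 / (1 - \<rho>) * \<rho> ^ n" "\<And>n. e n \<le> e 0 * \<rho> ^ n"
    proof (rule geometric_steps_converge[of \<rho> 2 e a w R])
      show "e (Suc n) \<le> \<rho> * e n \<and> norm (a (Suc n) - a n) \<le> 2 * e n" if "norm (a n - w) \<le> R" for n
        using contr[OF aA that aSuc] move[OF aA that aSuc] by (simp add: e_def)
    qed (use \<rho> start in \<open>auto simp: e_def\<close>)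
    have "c \<in> A" by (rule mem_closed_if_geometric[OF assms(1) ne(1) \<rho> c(1), of 0]) (simp add: aA)
    moreover have "c \<in> B" using mem_closed_if_geometric[OF assms(2) ne(2) \<rho> c(1), of "e 0"] c(2) by (simp add: e_inf)
    moreover have "norm (x - c) \<le> \<kappa> * (infdist x A + infdist x B)"
    proof -
      have "e 0 \<le> infdist x B + infdist x A"
        using infdist_triangle[of "a 0" B x] x_inf by (simp add: e_inf dist_norm norm_minus_commute)
      then have "2 * e 0 / (1 - \<rho>) \<le> 2 * (infdist x B + infdist x A) / (1 - \<rho>)"
        using \<rho> by (intro divide_right_mono) auto
      moreover have "norm (x - c) \<le> norm (x - a 0) + norm (a 0 - c)"
        using norm_triangle_ineq[of "x - a 0" "a 0 - c"] by simp
      ultimately have "norm (x - c) \<le> infdist x A + 2 * (infdist x B + infdist x A) / (1 - \<rho>)"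
        using c(1)[of 0] x_inf by simp
      also have "\<dots> \<le> \<kappa> * (infdist x A + infdist x B)" by (simp add: \<kappa>_def algebra_simps infdist_nonneg)
      finally show ?thesis .
    qed
    ultimately show ?thesis by blast
  qed
  show thesis by (rule that[of \<kappa> \<delta>]) (use main \<rho> R in \<open>auto simp: \<kappa>_def \<delta>_def\<close>)
qed

section \<open>One step of the operator inside the affine hull\<close>

text \<open>Expanding the square leaves a nonpositive term with factor
  \<open>lam * (2 - lam)\<close>, which is dropped, and the term
  \<open>2 * lam * ((x - a) \<bullet> (a - c))\<close>. Superregularity bounds the latter below; the
  8 comes from \<open>2 * lam \<le> 4\<close> and
  \<open>norm (a - c) \<le> 2 * norm (x - c)\<close>.\<close>

lemma relaxed_projection_estimate:
  assumes reg: "eps_delta_regular_at \<epsilon> \<delta> C w" and a: "a \<in> projector C x" "norm (a - w) \<le> \<delta>"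
    and c: "c \<in> C" "norm (c - w) \<le> \<delta>" and lam: "0 \<le> lam" "lam \<le> 2" and \<epsilon>: "0 \<le> \<epsilon>"
    and y: "y = (1 - lam) *\<^sub>R x + lam *\<^sub>R a"
  shows "(norm (y - c))\<^sup>2 \<le> (1 + 8 * \<epsilon>) * (norm (x - c))\<^sup>2"
proof -
  define D where "D = norm (x - c)"
  have le: "norm (x - a) \<le> D" "norm (a - c) \<le> 2 * D"
    using projector_le[OF a(1) c(1)] projector_dist[OF a(1) c(1)] by (auto simp: D_def)
  have "- \<epsilon> * norm (x - a) * norm (a - c) \<le> (x - a) \<bullet> (a - c)"
    by (rule eps_delta_regularD[OF reg a c])
  moreover have "\<epsilon> * norm (x - a) * norm (a - c) \<le> \<epsilon> * D * (2 * D)"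
    using le \<epsilon> norm_ge_zero[of "x - c"] unfolding D_def[symmetric] by (intro mult_mono) auto
  ultimately have 1: "- (\<epsilon> * D * (2 * D)) \<le> (x - a) \<bullet> (a - c)" by linarith
  have yc: "y - c = (x - c) - lam *\<^sub>R (x - a)" by (simp add: y algebra_simps)
  have "(norm (y - c))\<^sup>2 = D\<^sup>2 - 2 * lam * ((x - a) \<bullet> (x - c)) + lam\<^sup>2 * (norm (x - a))\<^sup>2"
    unfolding yc D_def power2_norm_eq_inner
    by (simp add: power2_norm_eq_inner inner_diff_left inner_diff_right inner_commute power2_eq_square algebra_simps)
  also have "(x - a) \<bullet> (x - c) = (x - a) \<bullet> (a - c) + (norm (x - a))\<^sup>2"
    by (simp add: power2_norm_eq_inner inner_diff inner_commute)
  finally have "(norm (y - c))\<^sup>2 = D\<^sup>2 - 2 * lam * ((x - a) \<bullet> (a - c)) - lam * (2 - lam) * (norm (x - a))\<^sup>2"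
    by (simp add: algebra_simps power2_eq_square)
  also have "\<dots> \<le> D\<^sup>2 - 2 * lam * ((x - a) \<bullet> (a - c))" using lam by simp
  also have "\<dots> \<le> D\<^sup>2 + 2 * lam * (\<epsilon> * D * (2 * D))"
    using mult_left_mono[OF 1, of "2 * lam"] lam by (simp only: mult_minus_right) linarith
  also have "2 * lam * (\<epsilon> * D * (2 * D)) \<le> 4 * (\<epsilon> * D * (2 * D))"
    by (rule mult_right_mono) (use lam \<epsilon> in \<open>simp_all add: D_def\<close>)
  finally show ?thesis by (simp add: D_def power2_eq_square algebra_simps)
qed

text \<open>Vectors that stay away from being opposite cannot cancel:
  \<open>2 * norm u * norm v\<close> is at most the sum of the squares, so the squared norm of
  \<open>u + v\<close> is at least \<open>1 - \<theta>\<close> times that sum.\<close>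

lemma norm_add_angle:
  fixes u v :: "'a::real_inner"
  assumes "- \<theta> * norm u * norm v \<le> u \<bullet> v" "0 \<le> \<theta>" "\<theta> \<le> 1"
  shows "sqrt (1 - \<theta>) * norm u \<le> norm (u + v)" "sqrt (1 - \<theta>) * norm v \<le> norm (u + v)"
proof -
  have "\<theta> * (2 * norm u * norm v) \<le> \<theta> * ((norm u)\<^sup>2 + (norm v)\<^sup>2)"
    using assms sum_squares_bound[of "norm u" "norm v"] by (intro mult_left_mono) auto
  moreover have "(norm (u + v))\<^sup>2 = (norm u)\<^sup>2 + 2 * (u \<bullet> v) + (norm v)\<^sup>2"
    by (simp add: power2_norm_eq_inner inner_add inner_commute)
  ultimately have *: "(1 - \<theta>) * (norm u)\<^sup>2 + (1 - \<theta>) * (norm v)\<^sup>2 \<le> (norm (u + v))\<^sup>2"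
    using assms(1) by (simp add: algebra_simps)
  have nn: "0 \<le> (1 - \<theta>) * (norm u)\<^sup>2" "0 \<le> (1 - \<theta>) * (norm v)\<^sup>2" using assms by auto
  have sq: "(sqrt (1 - \<theta>) * t)\<^sup>2 = (1 - \<theta>) * t\<^sup>2" for t using assms by (simp add: power_mult_distrib)
  have "(sqrt (1 - \<theta>) * norm u)\<^sup>2 \<le> (norm (u + v))\<^sup>2" "(sqrt (1 - \<theta>) * norm v)\<^sup>2 \<le> (norm (u + v))\<^sup>2"
    unfolding sq using * nn by linarith+
  then show "sqrt (1 - \<theta>) * norm u \<le> norm (u + v)" "sqrt (1 - \<theta>) * norm v \<le> norm (u + v)"
    by (auto elim: power2_le_imp_le)
qed

lemma norm_convex_combination:
  fixes x z c :: "'a::real_inner"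
  shows "(norm ((1 - \<alpha>) *\<^sub>R x + \<alpha> *\<^sub>R z - c))\<^sup>2 =
    (1 - \<alpha>) * (norm (x - c))\<^sup>2 + \<alpha> * (norm (z - c))\<^sup>2 - \<alpha> * (1 - \<alpha>) * (norm (x - z))\<^sup>2"
proof -
  have c: "(1 - \<alpha>) *\<^sub>R x + \<alpha> *\<^sub>R z - c = (1 - \<alpha>) *\<^sub>R (x - c) + \<alpha> *\<^sub>R (z - c)"
    by (simp add: algebra_simps)
  have d: "x - z = (x - c) - (z - c)" by simp
  show ?thesis unfolding c d power2_norm_eq_inner
    by (simp only: inner_diff_left inner_diff_right inner_add_left inner_add_right inner_scaleR_left
        inner_scaleR_right inner_commute[of "z - c" "x - c"]) algebra
qed

lemma mem_gDR_operator_iff: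
  "x' \<in> gDR_operator A B lam \<mu> \<alpha> x \<longleftrightarrow>
     (\<exists>a b y z. a \<in> projector A x \<and> y = (1 - lam) *\<^sub>R x + lam *\<^sub>R a \<and> b \<in> projector B y \<and>
        z = (1 - \<mu>) *\<^sub>R y + \<mu> *\<^sub>R b \<and> x' = (1 - \<alpha>) *\<^sub>R x + \<alpha> *\<^sub>R z)"
  unfolding gDR_operator_def relaxed_projector_def relax_def op_comp_def by blast

lemma affine_mem_combination:
  assumes "affine L" "p \<in> L" "q \<in> L"
  shows "(1 - t) *\<^sub>R p + t *\<^sub>R q \<in> L"
  using assms by (auto simp: affine_def)

text \<open>Distances are measured from the point \<open>c\<close> of \<open>A \<inter> B\<close>
  nearest to \<open>x\<close>. The two relaxed projections may increase the squared distance by the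
  factor \<open>1 + h\<close>; the averaging term, bounded below through the angle and linear
  regularity, gains twice as much as this costs.\<close>

lemma gDR_step_contraction:
  fixes A B :: "'a::euclidean_space set"
  assumes "closed A" "closed B" and w: "w \<in> A \<inter> B"
    and srA: "superregular_at A w" and srB: "superregular_at B w" and ahr: "affine_hull_regular_at A B w"
    and lam: "0 < lam" "lam \<le> 2" and \<mu>: "0 < \<mu>" "\<mu> \<le> 2" and \<alpha>: "0 < \<alpha>" "\<alpha> < 1"
  obtains \<rho> \<delta> where "0 \<le> \<rho>" "\<rho> < 1" "0 < \<delta>"
    "\<And>x x'. \<lbrakk>x \<in> affine hull (A \<union> B); norm (x - w) \<le> \<delta>; x' \<in> gDR_operator A B lam \<mu> \<alpha> x\<rbrakk> \<Longrightarrow>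
       infdist x' (A \<inter> B) \<le> \<rho> * infdist x (A \<inter> B) \<and> norm (x' - x) \<le> 8 * infdist x (A \<inter> B)"
proof -
  define L where "L = affine hull (A \<union> B)"
  define S where "S = (\<lambda>z. z - w) ` L"
  have ABL: "A \<subseteq> L" "B \<subseteq> L" and L: "affine L" by (auto simp: L_def hull_inc)
  have wL: "w \<in> L" using w ABL by auto
  have inS: "p - q \<in> S" if "p \<in> L" "q \<in> L" for p q
    unfolding S_def using L wL that by (rule affine_diff_mem)
  from affine_hull_regular_angle[OF ahr w, folded L_def, folded S_def]
  obtain \<theta> \<delta>1 where \<theta>: "0 \<le> \<theta>" "\<theta> < 1" "0 < \<delta>1"
    and angle: "\<And>a b u v. \<lbrakk>a \<in> A; norm (a - w) \<le> \<delta>1; b \<in> B; norm (b - w) \<le> \<delta>1; u \<in> prox_normal_cone A a;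
       v \<in> prox_normal_cone B b; u \<in> S; v \<in> S\<rbrakk> \<Longrightarrow> - \<theta> * norm u * norm v \<le> u \<bullet> v" by blast
  obtain \<kappa> \<delta>2 where \<kappa>: "1 \<le> \<kappa>" "0 < \<delta>2"
    "\<And>x. norm (x - w) \<le> \<delta>2 \<Longrightarrow> \<exists>c\<in>A \<inter> B. norm (x - c) \<le> \<kappa> * (infdist x A + infdist x B)"
    using linear_regularity[OF assms(1,2) w srB ahr] by blast
  \<comment> \<open>\<open>s\<close> will bound both projection displacements by the total one:
    \<open>s * norm (x - a)\<close> and \<open>s * norm (y - b)\<close> are at most
    \<open>norm (x - z)\<close>.\<close>
  define s where "s = sqrt (1 - \<theta>) * min lam \<mu>"
  \<comment> \<open>Linear regularity gives
    \<open>D \<le> \<kappa> * (3 * norm (x - a) + norm (y - b))\<close>, hence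
    \<open>\<nu> * D \<le> norm (x - z)\<close>; the 4 is 3 + 1.\<close>
  define \<nu> where "\<nu> = s / (4 * \<kappa>)"
  have s: "0 < s" using \<theta> lam \<mu> by (simp add: s_def)
  have "s \<le> 1 * 2" unfolding s_def using \<theta> lam \<mu> by (intro mult_mono) auto
  then have \<nu>: "0 < \<nu>" "\<nu> \<le> 1" using s \<kappa>(1) by (auto simp: \<nu>_def divide_simps)
  \<comment> \<open>Half of the gain coefficient \<open>(1 - \<alpha>) * \<nu>\<^sup>2\<close>; the
    other half absorbs the error from superregularity.\<close>
  define h where "h = (1 - \<alpha>) * \<nu>\<^sup>2 / 2"
  \<comment> \<open>Now \<open>1 + 8 * \<epsilon> = 1 + h / 3\<close>, whose square, the error
    factor of two relaxed projections, is at most \<open>1 + h\<close> because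
    \<open>h \<le> 1\<close>.\<close>
  define \<epsilon> where "\<epsilon> = h / 24"
  have "\<nu>\<^sup>2 \<le> 1" using \<nu> by (simp add: power_le_one)
  then have "(1 - \<alpha>) * \<nu>\<^sup>2 \<le> 1 * 1" using \<alpha> by (intro mult_mono) auto
  then have h: "0 < h" "h \<le> 1" using \<alpha> \<nu> by (auto simp: h_def)
  have \<epsilon>: "0 < \<epsilon>" using h by (simp add: \<epsilon>_def)
  have \<epsilon>h: "(1 + 8 * \<epsilon>)\<^sup>2 \<le> 1 + h"
  proof -
    have "h * h \<le> h * 1" using h by (intro mult_left_mono) auto
    moreover have "(1 + 8 * \<epsilon>)\<^sup>2 = 1 + 2 / 3 * h + h * h / 9" by (simp add: \<epsilon>_def power2_eq_square algebra_simps)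
    ultimately show ?thesis using h by linarith
  qed
  obtain \<delta>3 where \<delta>3: "0 < \<delta>3" "eps_delta_regular_at \<epsilon> \<delta>3 A w"
    using srA \<epsilon> by (auto simp: superregular_at_def)
  obtain \<delta>4 where \<delta>4: "0 < \<delta>4" "eps_delta_regular_at \<epsilon> \<delta>4 B w"
    using srB \<epsilon> by (auto simp: superregular_at_def)
  \<comment> \<open>For \<open>x\<close> within \<open>\<delta>\<close> of \<open>w\<close>, the
    points \<open>a\<close> and \<open>c\<close> lie within \<open>2 * \<delta>\<close>,
    \<open>y\<close> within \<open>3 * \<delta>\<close>, and \<open>b\<close> within
    \<open>6 * \<delta>\<close>.\<close>
  define \<delta> where "\<delta> = min (min \<delta>1 \<delta>2) (min \<delta>3 \<delta>4) / 6"
  have \<delta>: "0 < \<delta>" "6 * \<delta> \<le> \<delta>1" "6 * \<delta> \<le> \<delta>2" "6 * \<delta> \<le> \<delta>3" "6 * \<delta> \<le> \<delta>4"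
    using \<theta> \<kappa> \<delta>3 \<delta>4 by (auto simp: \<delta>_def)
  have "\<alpha> * h \<le> 1 * 1" using \<alpha> h by (intro mult_mono) auto
  then have \<alpha>h: "0 < \<alpha> * h" "\<alpha> * h \<le> 1" using \<alpha> h by auto
  define \<rho> where "\<rho> = sqrt (1 - \<alpha> * h)"
  have \<rho>: "0 \<le> \<rho>" "\<rho> < 1" "\<rho>\<^sup>2 = 1 - \<alpha> * h" using \<alpha>h by (auto simp: \<rho>_def)
  have main: "infdist x' (A \<inter> B) \<le> \<rho> * infdist x (A \<inter> B) \<and> norm (x' - x) \<le> 8 * infdist x (A \<inter> B)"
    if x: "x \<in> L" "norm (x - w) \<le> \<delta>" and x': "x' \<in> gDR_operator A B lam \<mu> \<alpha> x" for x x'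
  proof -
    obtain a b y z where a: "a \<in> projector A x" and y: "y = (1 - lam) *\<^sub>R x + lam *\<^sub>R a"
      and b: "b \<in> projector B y" and z: "z = (1 - \<mu>) *\<^sub>R y + \<mu> *\<^sub>R b" and x'z: "x' = (1 - \<alpha>) *\<^sub>R x + \<alpha> *\<^sub>R z"
      using x' mem_gDR_operator_iff by blast
    have "closed (A \<inter> B)" "A \<inter> B \<noteq> {}" using assms by auto
    from projector_nonempty[OF this] obtain c where c: "c \<in> projector (A \<inter> B) x" by blast
    have cAB: "c \<in> A" "c \<in> B" using projector_mem[OF c] by auto
    define D where "D = norm (x - c)"
    have D: "D = infdist x (A \<inter> B)" using c by (simp add: D_def projector_def)
    have aA: "a \<in> A" and bB: "b \<in> B" using a b projector_mem by blast+
    have yL: "y \<in> L" unfolding y using L x aA ABL by (intro affine_mem_combination) auto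
    have xy: "x - y = lam *\<^sub>R (x - a)" and yz: "y - z = \<mu> *\<^sub>R (y - b)" by (simp_all add: y z algebra_simps)
    have nxy: "norm (x - y) \<le> 2 * norm (x - a)" using lam by (simp add: xy mult_right_mono)
    have nyz: "norm (y - z) \<le> 2 * norm (y - b)" using \<mu> by (simp add: yz mult_right_mono)
    have near_a: "norm (a - w) \<le> 2 * \<delta>" and near_c: "norm (c - w) \<le> 2 * \<delta>"
      using projector_dist[OF a] projector_dist[OF c] w x by fastforce+
    have "norm (y - w) \<le> norm (x - y) + norm (x - w)"
      using norm_triangle_ineq[of "y - x" "x - w"] by (simp add: norm_minus_commute)
    moreover have "norm (x - a) \<le> norm (x - w)" using projector_le[OF a] w by auto
    ultimately have "norm (y - w) \<le> 3 * \<delta>" using nxy x(2) by linarith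
    then have near_b: "norm (b - w) \<le> 6 * \<delta>" using projector_dist[OF b, of w] w by simp
    have est_y: "(norm (y - c))\<^sup>2 \<le> (1 + 8 * \<epsilon>) * D\<^sup>2"
      unfolding D_def using near_a near_c \<delta> lam \<epsilon> cAB
      by (intro relaxed_projection_estimate[OF \<delta>3(2) a _ _ _ _ _ _ y]) auto
    have "(norm (z - c))\<^sup>2 \<le> (1 + 8 * \<epsilon>) * (norm (y - c))\<^sup>2"
      using near_b near_c \<delta> \<mu> \<epsilon> cAB
      by (intro relaxed_projection_estimate[OF \<delta>4(2) b _ _ _ _ _ _ z]) auto
    also have "\<dots> \<le> (1 + 8 * \<epsilon>) * ((1 + 8 * \<epsilon>) * D\<^sup>2)" using est_y \<epsilon> by (intro mult_left_mono) auto
    also have "\<dots> = (1 + 8 * \<epsilon>)\<^sup>2 * D\<^sup>2" by (simp add: power2_eq_square)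
    also have "\<dots> \<le> (1 + h) * D\<^sup>2" using \<epsilon>h by (intro mult_right_mono) auto
    finally have est_z: "(norm (z - c))\<^sup>2 \<le> (1 + h) * D\<^sup>2" .
    have ang: "- \<theta> * norm (x - a) * norm (y - b) \<le> (x - a) \<bullet> (y - b)"
      using near_a near_b \<delta> aA bB ABL x yL
      by (intro angle[of a b] inS prox_normal_coneI a b) auto
    \<comment> \<open>The angle bound survives scaling by the positive \<open>lam\<close> and
      \<open>\<mu>\<close>, and the scaled vectors add up to \<open>x - z\<close>.\<close>
    have ang': "- \<theta> * norm (lam *\<^sub>R (x - a)) * norm (\<mu> *\<^sub>R (y - b)) \<le> lam *\<^sub>R (x - a) \<bullet> \<mu> *\<^sub>R (y - b)"
      using mult_left_mono[OF ang, of "lam * \<mu>"] lam \<mu> by (simp add: mult_ac)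
    have xz: "x - z = lam *\<^sub>R (x - a) + \<mu> *\<^sub>R (y - b)" by (simp flip: xy yz)
    define r where "r = norm (x - z)"
    have ru: "s * norm (x - a) \<le> r"
    proof -
      have "s * norm (x - a) \<le> sqrt (1 - \<theta>) * lam * norm (x - a)"
        unfolding s_def using \<theta> by (intro mult_right_mono mult_left_mono) auto
      then show ?thesis using norm_add_angle(1)[OF ang'] \<theta> lam by (simp add: r_def xz mult.assoc)
    qed
    have rv: "s * norm (y - b) \<le> r"
    proof -
      have "s * norm (y - b) \<le> sqrt (1 - \<theta>) * \<mu> * norm (y - b)"
        unfolding s_def using \<theta> by (intro mult_right_mono mult_left_mono) auto
      then show ?thesis using norm_add_angle(2)[OF ang'] \<theta> \<mu> by (simp add: r_def xz mult.assoc)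
    qed
    have "infdist x A = norm (x - a)" "infdist y B = norm (y - b)" using a b by (auto simp: projector_def)
    \<comment> \<open>The distance from \<open>x\<close> to \<open>B\<close> goes through
      \<open>y\<close>, which costs \<open>norm (x - y) \<le> 2 * norm (x - a)\<close>.\<close>
    then have sum: "infdist x A + infdist x B \<le> 3 * norm (x - a) + norm (y - b)"
      using infdist_triangle[of x B y] nxy by (simp add: dist_norm)
    obtain c' where "c' \<in> A \<inter> B" "norm (x - c') \<le> \<kappa> * (infdist x A + infdist x B)"
      using \<kappa>(3)[of x] x \<delta> by auto
    then have "D \<le> \<kappa> * (infdist x A + infdist x B)" using projector_le[OF c] by (force simp: D_def)
    also have "\<dots> \<le> \<kappa> * (3 * norm (x - a) + norm (y - b))" using sum \<kappa> by (intro mult_left_mono) auto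
    finally have "s * D \<le> \<kappa> * (3 * (s * norm (x - a)) + s * norm (y - b))"
      using mult_left_mono[of D "\<kappa> * (3 * norm (x - a) + norm (y - b))" s] s by (simp add: algebra_simps)
    also have "\<dots> \<le> \<kappa> * (4 * r)" using ru rv \<kappa> by (intro mult_left_mono) auto
    finally have "\<nu> * D \<le> r" using \<kappa> by (simp add: \<nu>_def divide_simps mult_ac)
    then have "(\<nu> * D)\<^sup>2 \<le> r\<^sup>2" using \<nu> by (intro power_mono) (auto simp: D_def)
    then have "\<alpha> * (1 - \<alpha>) * (\<nu> * D)\<^sup>2 \<le> \<alpha> * (1 - \<alpha>) * r\<^sup>2" using \<alpha> by (intro mult_left_mono) auto
    moreover have "\<alpha> * (1 - \<alpha>) * (\<nu> * D)\<^sup>2 = 2 * (\<alpha> * h) * D\<^sup>2"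
      by (simp add: h_def power2_eq_square)
    moreover have "\<alpha> * (norm (z - c))\<^sup>2 \<le> \<alpha> * ((1 + h) * D\<^sup>2)" using est_z \<alpha> by (intro mult_left_mono) auto
    moreover have "(norm (x' - c))\<^sup>2 = (1 - \<alpha>) * D\<^sup>2 + \<alpha> * (norm (z - c))\<^sup>2 - \<alpha> * (1 - \<alpha>) * r\<^sup>2"
      unfolding x'z D_def r_def by (rule norm_convex_combination)
    \<comment> \<open>The coefficients add up to \<open>(1 - \<alpha>) + \<alpha> * (1 + h) - 2 *
      \<alpha> * h = 1 - \<alpha> * h\<close>.\<close>
    ultimately have "(norm (x' - c))\<^sup>2 \<le> (1 - \<alpha> * h) * D\<^sup>2" by (simp add: algebra_simps)
    then have "(norm (x' - c))\<^sup>2 \<le> (\<rho> * D)\<^sup>2" by (simp add: power_mult_distrib \<rho>(3))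
    then have "norm (x' - c) \<le> \<rho> * D" by (rule power2_le_imp_le) (simp add: \<rho> D_def)
    moreover have "infdist x' (A \<inter> B) \<le> norm (x' - c)"
      using infdist_le[of c "A \<inter> B" x'] cAB by (simp add: dist_norm)
    \<comment> \<open>\<open>norm (x - y) \<le> 2 * D\<close> gives
      \<open>norm (y - b) \<le> 3 * D\<close>, so the displacement to \<open>z\<close> is at most
      \<open>2 * D + 6 * D\<close>.\<close>
    moreover have "norm (x' - x) \<le> 8 * D"
    proof -
      have "norm (x - a) \<le> D" "norm (y - b) \<le> norm (y - c)"
        using projector_le[OF a] projector_le[OF b] cAB by (auto simp: D_def)
      moreover have "norm (y - c) \<le> norm (x - y) + D"
        using norm_triangle_ineq[of "y - x" "x - c"] by (simp add: D_def norm_minus_commute)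
      moreover have "norm (x - z) \<le> norm (x - y) + norm (y - z)"
        using norm_triangle_ineq[of "x - y" "y - z"] by simp
      ultimately have xz8: "norm (x - z) \<le> 8 * D" using nxy nyz by linarith
      have "x' - x = - (\<alpha> *\<^sub>R (x - z))" by (simp add: x'z algebra_simps)
      then have "norm (x' - x) = \<alpha> * norm (x - z)" using \<alpha> by simp
      also have "\<dots> \<le> 1 * norm (x - z)" using \<alpha> by (intro mult_right_mono) auto
      finally show ?thesis using xz8 by simp
    qed
    ultimately show ?thesis by (simp add: D)
  qed
  show thesis by (rule that[of \<rho> \<delta>]) (use main \<rho> \<delta> in \<open>auto simp: L_def\<close>)
qed

section \<open>The component orthogonal to the affine hull\<close>

text \<open>By Pythagoras, adding \<open>v\<close> changes all squared distances to points of
  \<open>C\<close> by the same constant, so the minimizers are the same.\<close>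

lemma projector_add_orthogonal:
  assumes orth: "\<And>c. c \<in> C \<Longrightarrow> v \<bullet> (p - c) = 0" and ne: "C \<noteq> {}"
  shows "projector C (p + v) = projector C p"
proof -
  have "(norm (p + v - c))\<^sup>2 = (norm (p - c))\<^sup>2 + (norm v)\<^sup>2" if "c \<in> C" for c
  proof -
    have "p + v - c = (p - c) + v" by simp
    also have "(norm \<dots>)\<^sup>2 = (norm (p - c))\<^sup>2 + (norm v)\<^sup>2"
      using orth[OF that] dot_norm[of v "p - c"] by (simp add: add.commute)
    finally show ?thesis .
  qed
  then have "norm (p + v - c) \<le> norm (p + v - y) \<longleftrightarrow> norm (p - c) \<le> norm (p - y)" if "c \<in> C" "y \<in> C" for c y
    using that abs_le_square_iff[of "norm (p + v - c)" "norm (p + v - y)"] abs_le_square_iff[of "norm (p - c)" "norm (p - y)"]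
    by simp
  then show ?thesis unfolding set_eq_iff mem_projector_iff[OF ne] by blast
qed

text \<open>The projections ignore \<open>v\<close>, so the relaxations multiply it by
  \<open>1 - lam\<close> and \<open>1 - \<mu>\<close>, and averaging with the identity gives the
  coefficient subtracted in \<open>p'\<close>. What remains is a step of the same operator inside
  \<open>L\<close>.\<close>

lemma gDR_operator_add_orthogonal:
  fixes A B :: "'a::euclidean_space set"
  assumes L: "affine L" "A \<subseteq> L" "B \<subseteq> L" "A \<noteq> {}" "B \<noteq> {}" and p: "p \<in> L"
    and orth: "\<And>c d. c \<in> L \<Longrightarrow> d \<in> L \<Longrightarrow> v \<bullet> (c - d) = 0"
    and x': "x' \<in> gDR_operator A B lam \<mu> \<alpha> (p + v)"
  defines "p' \<equiv> x' - ((1 - \<alpha>) + \<alpha> * ((1 - lam) * (1 - \<mu>))) *\<^sub>R v"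
  shows "p' \<in> gDR_operator A B lam \<mu> \<alpha> p" "p' \<in> L"
proof -
  obtain a b y z where a: "a \<in> projector A (p + v)" and y: "y = (1 - lam) *\<^sub>R (p + v) + lam *\<^sub>R a"
    and b: "b \<in> projector B y" and z: "z = (1 - \<mu>) *\<^sub>R y + \<mu> *\<^sub>R b"
    and x'z: "x' = (1 - \<alpha>) *\<^sub>R (p + v) + \<alpha> *\<^sub>R z"
    using x' mem_gDR_operator_iff by blast
  define y0 where "y0 = (1 - lam) *\<^sub>R p + lam *\<^sub>R a"
  define z0 where "z0 = (1 - \<mu>) *\<^sub>R y0 + \<mu> *\<^sub>R b"
  have a0: "a \<in> projector A p" using a projector_add_orthogonal[of A v p] orth p L by auto
  then have aL: "a \<in> L" using projector_mem L by blast
  then have y0L: "y0 \<in> L" unfolding y0_def by (intro affine_mem_combination L p)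
  have yy0: "y = y0 + (1 - lam) *\<^sub>R v" by (simp add: y y0_def algebra_simps)
  then have b0: "b \<in> projector B y0"
    using b projector_add_orthogonal[of B "(1 - lam) *\<^sub>R v" y0] orth y0L L by auto
  then have "b \<in> L" using projector_mem L by blast
  then have z0L: "z0 \<in> L" unfolding z0_def by (intro affine_mem_combination L y0L)
  have p': "p' = (1 - \<alpha>) *\<^sub>R p + \<alpha> *\<^sub>R z0"
    by (simp add: p'_def x'z z yy0 z0_def algebra_simps)
  show "p' \<in> L" unfolding p' by (intro affine_mem_combination L p z0L)
  show "p' \<in> gDR_operator A B lam \<mu> \<alpha> p"
    using a0 b0 y0_def z0_def p' mem_gDR_operator_iff by blast
qed

lemma closest_point_affine_orthogonal:
  fixes L :: "'a::euclidean_space set"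
  assumes L: "affine L" and cd: "c \<in> L" "d \<in> L"
  shows "(x - closest_point L x) \<bullet> (c - d) = 0"
proof -
  have pL: "closest_point L x \<in> L" using closest_point_in_set[OF affine_closed[OF L]] cd by auto
  have le: "(x - closest_point L x) \<bullet> (q - closest_point L x) \<le> 0" if "q \<in> L" for q
    using closest_point_dot[OF affine_imp_convex[OF L] affine_closed[OF L] that] .
  \<comment> \<open>An affine set allows moving from the closest point by both \<open>c - d\<close>
    and its negative, so the obtuse angle inequality becomes an equality.\<close>
  have "closest_point L x + c - d \<in> L" "closest_point L x + d - c \<in> L"
    using mem_affine_3_minus[OF L pL cd, of 1] mem_affine_3_minus[OF L pL cd(2,1), of 1] by (auto simp: algebra_simps)
  then show ?thesis
    using le[of "closest_point L x + c - d"] le[of "closest_point L x + d - c"]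
    by (simp add: inner_diff_right algebra_simps)
qed

section \<open>Convergence inside the affine hull and in the whole space\<close>

lemma gDR_converges_in_affine_hull:
  fixes A B :: "'a::euclidean_space set"
  assumes "closed A" "closed B" and w: "w \<in> A \<inter> B"
    and "superregular_at A w" "superregular_at B w" "affine_hull_regular_at A B w"
    and "0 < lam" "lam \<le> 2" "0 < \<mu>" "\<mu> \<le> 2" "0 < \<alpha>" "\<alpha> < 1"
  obtains r where "0 < r"
    "\<And>p. \<lbrakk>generated_by (gDR_operator A B lam \<mu> \<alpha>) p; \<And>n. p n \<in> affine hull (A \<union> B); norm (p 0 - w) \<le> r\<rbrakk>
       \<Longrightarrow> \<exists>c\<in>A \<inter> B. R_linearly_converges p c"
proof -
  obtain \<rho> \<delta> where \<rho>: "0 \<le> \<rho>" "\<rho> < 1" and \<delta>: "0 < \<delta>"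
    and step: "\<And>x x'. \<lbrakk>x \<in> affine hull (A \<union> B); norm (x - w) \<le> \<delta>; x' \<in> gDR_operator A B lam \<mu> \<alpha> x\<rbrakk> \<Longrightarrow>
       infdist x' (A \<inter> B) \<le> \<rho> * infdist x (A \<inter> B) \<and> norm (x' - x) \<le> 8 * infdist x (A \<inter> B)"
    using gDR_step_contraction[OF assms] by blast
  \<comment> \<open>Since \<open>w\<close> lies in \<open>A \<inter> B\<close>, also
    \<open>e 0 \<le> r\<close>. The start then uses at most \<open>\<delta> / 9\<close> and the
    total movement at most \<open>8 * \<delta> / 9\<close>.\<close>
  define r where "r = \<delta> * (1 - \<rho>) / 9"
  have r: "0 < r" using \<rho> \<delta> by (simp add: r_def)
  have "\<exists>c\<in>A \<inter> B. R_linearly_converges p c"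
    if gen: "generated_by (gDR_operator A B lam \<mu> \<alpha>) p" and pL: "\<And>n. p n \<in> affine hull (A \<union> B)"
      and p0: "norm (p 0 - w) \<le> r" for p
  proof -
    define e where "e n = infdist (p n) (A \<inter> B)" for n
    have e0: "e 0 \<le> r" using infdist_le[OF w, of "p 0"] p0 by (simp add: e_def dist_norm)
    have "8 * e 0 / (1 - \<rho>) \<le> 8 * r / (1 - \<rho>)" using e0 \<rho> by (intro divide_right_mono) auto
    also have "\<dots> = 8 * \<delta> / 9" using \<rho> by (simp add: r_def divide_simps)
    finally have "8 * e 0 / (1 - \<rho>) \<le> 8 * \<delta> / 9" .
    moreover have "\<delta> * (1 - \<rho>) \<le> \<delta>" using \<rho> \<delta> by (simp add: mult_left_le)
    ultimately have start: "norm (p 0 - w) + 8 * e 0 / (1 - \<rho>) \<le> \<delta>" using p0 by (simp add: r_def)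
    obtain c where c: "\<And>n. norm (p n - c) \<le> 8 * e 0 / (1 - \<rho>) * \<rho> ^ n" "\<And>n. e n \<le> e 0 * \<rho> ^ n"
    proof (rule geometric_steps_converge[of \<rho> 8 e p w \<delta>])
      show "e (Suc n) \<le> \<rho> * e n \<and> norm (p (Suc n) - p n) \<le> 8 * e n" if "norm (p n - w) \<le> \<delta>" for n
        using step[OF pL that] gen by (simp add: e_def generated_by_def)
    qed (use \<rho> start in \<open>auto simp: e_def infdist_nonneg\<close>)
    have "closed (A \<inter> B)" "A \<inter> B \<noteq> {}" using assms by auto
    from mem_closed_if_geometric[OF this \<rho> c(1), of "e 0"] c(2) have "c \<in> A \<inter> B" by (simp add: e_def)
    moreover have "R_linearly_converges p c" unfolding R_linearly_converges_def
      using c(1) \<rho> by (intro exI[of _ \<rho>] exI[of _ "8 * e 0 / (1 - \<rho>)"]) (auto simp: e_def infdist_nonneg)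
    ultimately show ?thesis by blast
  qed
  with r show thesis by (rule that)
qed

lemma R_linearly_converges_add:
  assumes "R_linearly_converges p c" and t: "\<bar>t\<bar> < 1"
  shows "R_linearly_converges (\<lambda>n. p n + t ^ n *\<^sub>R v) c"
proof -
  obtain \<rho> \<sigma> where \<rho>: "0 \<le> \<rho>" "\<rho> < 1" "0 \<le> \<sigma>" and conv: "\<And>n. norm (p n - c) \<le> \<sigma> * \<rho> ^ n"
    using assms(1) by (auto simp: R_linearly_converges_def)
  define q where "q = max \<rho> \<bar>t\<bar>"
  have "norm (p n + t ^ n *\<^sub>R v - c) \<le> (\<sigma> + norm v) * q ^ n" for n
  proof -
    have "norm (p n + t ^ n *\<^sub>R v - c) \<le> norm (p n - c) + norm (t ^ n *\<^sub>R v)"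
      using norm_triangle_ineq[of "p n - c" "t ^ n *\<^sub>R v"] by (simp add: algebra_simps)
    also have "\<dots> \<le> \<sigma> * \<rho> ^ n + norm v * \<bar>t\<bar> ^ n" using conv[of n] by (simp add: power_abs mult.commute)
    also have "\<dots> \<le> \<sigma> * q ^ n + norm v * q ^ n"
      using \<rho> by (intro add_mono mult_left_mono power_mono) (auto simp: q_def)
    finally show ?thesis by (simp add: algebra_simps)
  qed
  then show ?thesis unfolding R_linearly_converges_def
    using \<rho> t by (intro exI[of _ q] exI[of _ "\<sigma> + norm v"]) (auto simp: q_def)
qed

theorem theorem5p25:
  fixes A B L :: "'a::euclidean_space set" and w :: 'a and lam \<mu> \<alpha> :: real
    and T :: "'a \<Rightarrow> 'a set"
  assumes "closed A" and "closed B" and "A \<inter> B \<noteq> {}" and "w \<in> A \<inter> B"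
    and L: "L = affine hull (A \<union> B)"
    and "superregular_at A w" and "superregular_at B w"
    and "affine_hull_regular_at A B w"
    and "0 < lam" and "lam \<le> 2" and "0 < \<mu>" and "\<mu> \<le> 2"
    and "0 < \<alpha>" and "\<alpha> < 1"
    and T: "T = gDR_operator A B lam \<mu> \<alpha>"
  shows
    "(lam = 2 \<and> \<mu> = 2 \<longrightarrow>
       (\<exists>r>0. \<forall>x. generated_by T x \<and> norm (closest_point L (x 0) - w) \<le> r \<longrightarrow>
         (\<exists>xbar \<in> Fix T. R_linearly_converges x xbar \<and>
            (\<exists>c \<in> A \<inter> B. projector A xbar = {c} \<and> projector B xbar = {c})))) \<and>
     (lam < 2 \<or> \<mu> < 2 \<longrightarrow>
       (\<exists>r>0. \<forall>x. generated_by T x \<and> norm (closest_point L (x 0) - w) \<le> r \<longrightarrow>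
         (\<exists>xbar \<in> A \<inter> B. R_linearly_converges x xbar)))"
proof -
  have LA: "affine L" "A \<subseteq> L" "B \<subseteq> L" and ne: "A \<noteq> {}" "B \<noteq> {}"
    using assms by (auto simp: L hull_inc)
  have wL: "w \<in> L" using assms LA by auto
  \<comment> \<open>The factor by which one step multiplies the component orthogonal to
    \<open>L\<close>.\<close>
  define \<tau> where "\<tau> = (1 - \<alpha>) + \<alpha> * ((1 - lam) * (1 - \<mu>))"
  obtain r where r: "0 < r" and conv: "\<And>p. \<lbrakk>generated_by T p; \<And>n. p n \<in> L; norm (p 0 - w) \<le> r\<rbrakk>
       \<Longrightarrow> \<exists>c\<in>A \<inter> B. R_linearly_converges p c"
    using gDR_converges_in_affine_hull[of A B w lam \<mu> \<alpha>] assms unfolding T L by metis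
  \<comment> \<open>Both claims follow from this decomposition, with the same \<open>r\<close>:
    \<open>p\<close> runs inside \<open>L\<close> and converges to \<open>c\<close>, while
    \<open>v\<close> is the orthogonal part of \<open>x 0\<close>. Only the size of
    \<open>\<tau>\<close> distinguishes the cases.\<close>
  have split: "\<exists>p c v. c \<in> A \<inter> B \<and> R_linearly_converges p c \<and> x = (\<lambda>n. p n + \<tau> ^ n *\<^sub>R v) \<and>
      (\<forall>y\<in>L. \<forall>z\<in>L. v \<bullet> (y - z) = 0)"
    if gen: "generated_by T x" and x0: "norm (closest_point L (x 0) - w) \<le> r" for x
  proof -
    define v where "v = x 0 - closest_point L (x 0)"
    define p where "p n = x n - \<tau> ^ n *\<^sub>R v" for n
    have orth: "v \<bullet> (y - z) = 0" if "y \<in> L" "z \<in> L" for y z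
      unfolding v_def using LA(1) that by (rule closest_point_affine_orthogonal)
    have p: "p n \<in> L \<and> p (Suc n) \<in> T (p n) \<and> p (Suc n) \<in> L" for n
    proof (induction n)
      have stp: "p (Suc n) \<in> T (p n) \<and> p (Suc n) \<in> L" if "p n \<in> L" for n
      proof -
        have "x (Suc n) \<in> gDR_operator A B lam \<mu> \<alpha> (p n + \<tau> ^ n *\<^sub>R v)"
          using gen by (simp add: generated_by_def p_def T)
        from gDR_operator_add_orthogonal[OF LA ne that _ this, folded \<tau>_def] orth
        show ?thesis by (simp add: p_def T)
      qed
      {
        case 0
        have "p 0 \<in> L" using closest_point_in_set[OF affine_closed[OF LA(1)]] wL by (auto simp: p_def v_def)
        with stp show ?case by blast
      next
        case (Suc n)
        with stp show ?case by blast
      }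
    qed
    have "norm (p 0 - w) \<le> r" using x0 by (simp add: p_def v_def)
    then obtain c where "c \<in> A \<inter> B" "R_linearly_converges p c"
      using conv[of p] p by (auto simp: generated_by_def)
    moreover have "x = (\<lambda>n. p n + \<tau> ^ n *\<^sub>R v)" by (simp add: p_def)
    ultimately show ?thesis using orth by blast
  qed
  show ?thesis
  proof (intro conjI impI)
    assume two: "lam = 2 \<and> \<mu> = 2"
    then have \<tau>1: "\<tau> = 1" by (simp add: \<tau>_def)
    show "\<exists>r>0. \<forall>x. generated_by T x \<and> norm (closest_point L (x 0) - w) \<le> r \<longrightarrow>
         (\<exists>xbar \<in> Fix T. R_linearly_converges x xbar \<and>
            (\<exists>c \<in> A \<inter> B. projector A xbar = {c} \<and> projector B xbar = {c}))"
    proof (intro exI[of _ r] conjI r allI impI)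
      fix x assume "generated_by T x \<and> norm (closest_point L (x 0) - w) \<le> r"
      then obtain p c v where c: "c \<in> A \<inter> B" and pc: "R_linearly_converges p c"
        and x: "x = (\<lambda>n. p n + \<tau> ^ n *\<^sub>R v)" and orth: "\<forall>y\<in>L. \<forall>z\<in>L. v \<bullet> (y - z) = 0"
        using split by blast
      have self: "projector C c = {c}" if "c \<in> C" for C :: "'a set"
        using that by (auto simp: projector_def)
      have proj: "projector A (c + t *\<^sub>R v) = {c}" "projector B (c + t *\<^sub>R v) = {c}" for t
      proof -
        have "projector C (c + t *\<^sub>R v) = projector C c" if "c \<in> C" "C \<subseteq> L" for C
          using that orth by (intro projector_add_orthogonal) auto
        then show "projector A (c + t *\<^sub>R v) = {c}" "projector B (c + t *\<^sub>R v) = {c}"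
          using c LA self by auto
      qed
      \<comment> \<open>Reflecting \<open>c + v\<close> through \<open>c\<close> gives
        \<open>c - v\<close>, and reflecting again gives \<open>c + v\<close> back, so
        \<open>z\<close> equals the starting point.\<close>
      have "c + v \<in> T (c + v)" unfolding T mem_gDR_operator_iff
      proof (intro exI conjI)
        show "c \<in> projector A (c + v)" using proj(1)[of 1] by simp
        show "c \<in> projector B (c - v)" using proj(2)[of "-1"] by simp
      qed (use two in \<open>auto simp: algebra_simps scaleR_2\<close>)
      \<comment> \<open>As \<open>\<tau> = 1\<close>, the orthogonal part stays equal to
        \<open>v\<close>, and \<open>x\<close> is \<open>p\<close> shifted by a constant.\<close>
      moreover have "R_linearly_converges x (c + v)"
        using pc by (simp add: R_linearly_converges_def x \<tau>1)
      ultimately show "\<exists>xbar \<in> Fix T. R_linearly_converges x xbar \<and>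
            (\<exists>c \<in> A \<inter> B. projector A xbar = {c} \<and> projector B xbar = {c})"
        using c proj[of 1] by (intro bexI[of _ "c + v"]) (auto simp: Fix_def)
    qed
  next
    assume lt2: "lam < 2 \<or> \<mu> < 2"
    have l: "\<bar>1 - lam\<bar> \<le> 1" "\<bar>1 - \<mu>\<bar> \<le> 1" using assms by auto
    have "\<bar>1 - lam\<bar> < 1 \<or> \<bar>1 - \<mu>\<bar> < 1" using lt2 assms by auto
    \<comment> \<open>Both factors are at most 1 and one is strictly smaller; this is where a
      relaxation parameter below 2 makes the orthogonal part decay.\<close>
    then have "\<bar>1 - lam\<bar> * \<bar>1 - \<mu>\<bar> < 1"
      using l mult_left_le[of "\<bar>1 - \<mu>\<bar>" "\<bar>1 - lam\<bar>"] mult_left_le_one_le[of "\<bar>1 - \<mu>\<bar>" "\<bar>1 - lam\<bar>"] by auto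
    then have "\<bar>(1 - lam) * (1 - \<mu>)\<bar> < 1" by (simp add: abs_mult)
    then have "\<alpha> * \<bar>(1 - lam) * (1 - \<mu>)\<bar> < \<alpha> * 1" using assms by (intro mult_strict_left_mono) auto
    moreover have "\<bar>\<tau>\<bar> \<le> (1 - \<alpha>) + \<alpha> * \<bar>(1 - lam) * (1 - \<mu>)\<bar>"
      unfolding \<tau>_def using abs_triangle_ineq[of "1 - \<alpha>" "\<alpha> * ((1 - lam) * (1 - \<mu>))"] assms
      by (simp add: abs_mult)
    ultimately have \<tau>: "\<bar>\<tau>\<bar> < 1" by linarith
    show "\<exists>r>0. \<forall>x. generated_by T x \<and> norm (closest_point L (x 0) - w) \<le> r \<longrightarrow>
         (\<exists>xbar \<in> A \<inter> B. R_linearly_converges x xbar)"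
      using r split R_linearly_converges_add[OF _ \<tau>] by blast
  qed
qed

end
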